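(* There exists an involution $\Upsilon$ on $\mathcal{S}_n(312)$ such that for every $\pi\in\mathcal{S}_n(312)$, $$(\mathsf{pk},\mathsf{dd},\mathsf{da})(\Upsilon(\pi))=(\mathsf{pk},\mathsf{dd},\mathsf{da})(\pi)\quad\text{and}\quad(\mathsf{st}_1,\mathsf{st}_2)(\Upsilon(\pi))=(\mathsf{st}_2,\mathsf{st}_1)(\pi).$$
   Context: $n\ge1$ and $\mathcal{S}_n$ is the set of permutations $\pi=\pi_1\pi_2\cdots\pi_n$ of $\{1,\ldots,n\}$. $\mathcal{S}_n(312)$ is the set of $\pi\in\mathcal{S}_n$ for which there are no indices $i<j<k$ with $\pi_i>\pi_k>\pi_j$. With the convention $\pi_0=\pi_{n+1}=0$, a letter $\pi_i$ ($1\le i\le n$) is a peak if $\pi_{i-1}<\pi_i>\pi_{i+1}$, a double descent if $\pi_{i-1}>\pi_i>\pi_{i+1}$, and a double ascent if $\pi_{i-1}<\pi_i<\pi_{i+1}$; $\mathsf{pk}(\pi),\mathsf{dd}(\pi),\mathsf{da}(\pi)$ are the numbers of peaks, double descents and double ascents. For $\sigma\in\mathcal{S}_k$ and a word $w=w_1\cdots w_m$ of distinct nonnegative integers, $\underline{\sigma}(w)$ is the number of consecutive occurrences of $\sigma$ in $w$, i.e. of subwords $w_iw_{i+1}\cdots w_{i+k-1}$ order isomorphic to $\sigma$. Then $\mathsf{st}_1(\pi):=\underline{1324}(0\pi)$ and $\mathsf{st}_2(\pi):=\underline{3241}(\pi0)$, where $0\pi$ (resp. $\pi0$) is the word obtained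 by placing $0$ in front of (resp. after) $\pi$. *)

theory Defs
  imports "HOL-Combinatorics.Multiset_Permutations"
begin

text \<open>
  Permutations of \<open>{1..n}\<close> are written in one-line notation, as members of
  \<^term>\<open>permutations_of_set {1..n}\<close>; list positions start at \<open>0\<close>, so \<open>\<pi> ! i\<close> is the letter
  \<open>\<pi>\<^sub>i\<^sub>+\<^sub>1\<close>.
\<close>

definition avoids_312 :: "nat list \<Rightarrow> bool" where
  "avoids_312 w \<longleftrightarrow>
     \<not> (\<exists>i j k. i < j \<and> j < k \<and> k < length w \<and> w ! i > w ! k \<and> w ! k > w ! j)"

definition perms_312 :: "nat \<Rightarrow> nat list set" where
  "perms_312 n = {\<pi> \<in> permutations_of_set {1..n}. avoids_312 \<pi>}"

text \<open>
  In the padded word the convention \<open>\<pi>\<^sub>0 = \<pi>\<^sub>n\<^sub>+\<^sub>1 = 0\<close> holds and the list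
  position of a letter coincides with its index \<open>1 \<le> i \<le> n\<close>.
\<close>

definition padded :: "nat list \<Rightarrow> nat list" where
  "padded \<pi> = 0 # \<pi> @ [0]"

definition pk :: "nat list \<Rightarrow> nat" where
  "pk \<pi> = card {i \<in> {1..length \<pi>}.
     padded \<pi> ! (i - 1) < padded \<pi> ! i \<and> padded \<pi> ! i > padded \<pi> ! (i + 1)}"

definition dd :: "nat list \<Rightarrow> nat" where
  "dd \<pi> = card {i \<in> {1..length \<pi>}.
     padded \<pi> ! (i - 1) > padded \<pi> ! i \<and> padded \<pi> ! i > padded \<pi> ! (i + 1)}"

definition da :: "nat list \<Rightarrow> nat" where
  "da \<pi> = card {i \<in> {1..length \<pi>}.
     padded \<pi> ! (i - 1) < padded \<pi> ! i \<and> padded \<pi> ! i < padded \<pi> ! (i + 1)}"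

definition order_isomorphic :: "nat list \<Rightarrow> nat list \<Rightarrow> bool" where
  "order_isomorphic u v \<longleftrightarrow> length u = length v \<and>
     (\<forall>i < length u. \<forall>j < length u. u ! i < u ! j \<longleftrightarrow> v ! i < v ! j)"

definition consecutive_occurrences :: "nat list \<Rightarrow> nat list \<Rightarrow> nat" where
  "consecutive_occurrences \<sigma> w =
     card {i. i + length \<sigma> \<le> length w \<and> order_isomorphic (take (length \<sigma>) (drop i w)) \<sigma>}"

definition st\<^sub>1 :: "nat list \<Rightarrow> nat" where
  "st\<^sub>1 \<pi> = consecutive_occurrences [1, 3, 2, 4] (0 # \<pi>)"

definition st\<^sub>2 :: "nat list \<Rightarrow> nat" where
  "st\<^sub>2 \<pi> = consecutive_occurrences [3, 2, 4, 1] (\<pi> @ [0])"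

definition involution_on :: "'a set \<Rightarrow> ('a \<Rightarrow> 'a) \<Rightarrow> bool" where
  "involution_on A f \<longleftrightarrow> (\<forall>x \<in> A. f x \<in> A \<and> f (f x) = x)"

end

theory Submission
  imports Defs
begin

text \<open>
  A nonempty word avoiding 312 splits at its least letter \<open>c\<close> as \<open>A c B\<close>, and a letter of \<open>A\<close>
  exceeding a letter of \<open>B\<close> would form a 312 with \<open>c\<close>; so every letter of \<open>A\<close> lies below every
  letter of \<open>B\<close> (\<open>avoids_312_split_at_min\<close>). Repeating this on \<open>A\<close> and \<open>B\<close>, a permutation in
  \<^term>\<open>perms_312 n\<close> amounts to an unlabelled binary tree with \<open>n\<close> nodes, of which the
  permutation is the in-order reading (\<open>bij_betw_word\<close>).

  All five statistics are visible on the tree. A letter is followed by a larger letter iff its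
  node has a right child, and preceded by a larger letter iff its node has a left child; so peaks
  are nodes without children, double descents are nodes with only a left child and double ascents
  are nodes with only a right child (\<open>windows_3_word\<close>). In an occurrence \<open>a b c d\<close> of 1324, the
  letter \<open>c\<close> has two children because \<open>b > c < d\<close>, and \<open>a < c\<close> says that the left subtree of
  \<open>c\<close> consists of \<open>b\<close> alone; conversely such a node always yields an occurrence, as \<open>b < d\<close>
  holds automatically. So \<^term>\<open>st\<^sub>1\<close> counts the nodes with two children whose left subtree is a
  single node (\<open>st1_word\<close>), and symmetrically \<^term>\<open>st\<^sub>2\<close> counts those whose right subtree is a
  single node (\<open>st2_word\<close>).

  Exchanging the two subtrees at every node that has two children, and leaving the nodes with
  fewer children alone, is therefore the required involution: it keeps the type of each node and
  the size of each subtree, but exchanges left and right exactly where \<^term>\<open>st\<^sub>1\<close> and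
  \<^term>\<open>st\<^sub>2\<close> look.
\<close>

section \<open>Counting windows of a word\<close>

definition windows :: "nat \<Rightarrow> ('a list \<Rightarrow> bool) \<Rightarrow> 'a list \<Rightarrow> nat" where
  "windows k P w = card {i. i + k \<le> length w \<and> P (take k (drop i w))}"

lemma windows_short: "length w < k \<Longrightarrow> windows k P w = 0"
  by (simp add: windows_def)

lemma windows_Cons:
  "windows k P (x # w) =
     of_bool (k \<le> Suc (length w) \<and> P (take k (x # w))) + windows k P w"
proof -
  let ?S = "{i. i + k \<le> length w \<and> P (take k (drop i w))}"
  let ?Z = "{i::nat. i = 0 \<and> k \<le> Suc (length w) \<and> P (take k (x # w))}"
  have "{i. i + k \<le> length (x # w) \<and> P (take k (drop i (x # w)))} = ?Z \<union> Suc ` ?S"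
  proof (intro set_eqI)
    fix i show "i \<in> {i. i + k \<le> length (x # w) \<and> P (take k (drop i (x # w)))} \<longleftrightarrow>
        i \<in> ?Z \<union> Suc ` ?S"
      by (cases i) auto
  qed
  moreover have "card (?Z \<union> Suc ` ?S) = card ?Z + card (Suc ` ?S)"
    by (intro card_Un_disjoint finite_imageI)
      (auto intro: finite_subset[of _ "{..length w}"])
  moreover have "card ?Z = of_bool (k \<le> Suc (length w) \<and> P (take k (x # w)))"
    by auto
  ultimately show ?thesis
    by (simp add: windows_def card_image)
qed

text \<open>
  A window of length \<open>k\<close> that meets both sides of a factor of length \<open>k - 1\<close> would be too long,
  so cutting a word there with overlap counts every window once.
\<close>

lemma windows_overlap:
  assumes "Suc (length s) = k"
  shows "windows k P (u @ s @ v) = windows k P (u @ s) + windows k P (s @ v)"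
  using assms by (induction u) (auto simp: windows_Cons windows_short)

lemma card_padded_triples:
  "card {i \<in> {1..length \<pi>}. R (padded \<pi> ! (i - 1)) (padded \<pi> ! i) (padded \<pi> ! (i + 1))} =
     windows 3 (\<lambda>v. R (v ! 0) (v ! 1) (v ! 2)) (0 # \<pi> @ [0])"
proof -
  let ?S = "{i. i + 3 \<le> length (padded \<pi>) \<and>
    R (padded \<pi> ! i) (padded \<pi> ! (i + 1)) (padded \<pi> ! (i + 2))}"
  have "{i \<in> {1..length \<pi>}. R (padded \<pi> ! (i - 1)) (padded \<pi> ! i) (padded \<pi> ! (i + 1))} =
      Suc ` ?S"
  proof (intro set_eqI)
    fix i
    show "i \<in> {i \<in> {1..length \<pi>}.
        R (padded \<pi> ! (i - 1)) (padded \<pi> ! i) (padded \<pi> ! (i + 1))} \<longleftrightarrow> i \<in> Suc ` ?S"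
      by (cases i) (auto simp: padded_def)
  qed
  moreover have "?S = {i. i + 3 \<le> length (padded \<pi>) \<and>
      (\<lambda>v. R (v ! 0) (v ! 1) (v ! 2)) (take 3 (drop i (padded \<pi>)))}"
    by auto
  moreover have "card (Suc ` ?S) = card ?S"
    by (simp add: card_image)
  ultimately show ?thesis
    by (simp only: windows_def padded_def)
qed

section \<open>Binary trees and their 312-avoiding readings\<close>

datatype tree = Empty | Node tree tree

text \<open>
  The in-order reading, where letters are assigned in pre-order starting at \<open>k + 1\<close>: the root
  gets the least letter and the left subtree the smaller of the others.
\<close>

fun word :: "tree \<Rightarrow> nat \<Rightarrow> nat list" where
  "word Empty k = []"
| "word (Node l r) k = word l (Suc k) @ Suc k # word r (Suc k + size l)"

lemma length_word [simp]: "length (word t k) = size t"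
  by (induction t arbitrary: k) auto

lemma size_0_iff_Empty [simp]: "size (t::tree) = 0 \<longleftrightarrow> t = Empty"
  by (cases t) auto

lemma word_eq_Nil_iff [simp]: "word t k = [] \<longleftrightarrow> t = Empty"
  by (cases t) auto

lemma set_word: "set (word t k) = {k<..k + size t}"
  by (induction t arbitrary: k) auto

lemma distinct_word: "distinct (word t k)"
  by (induction t arbitrary: k) (auto simp: set_word)

lemma word_inject: "word t k = word t' k \<Longrightarrow> t = t'"
proof (induction t arbitrary: t' k)
  case Empty
  then show ?case by (cases t') auto
next
  case (Node l r)
  then obtain l' r' where t': "t' = Node l' r'"
    by (cases t') auto
  have "word l (Suc k) = word l' (Suc k)" "word r (Suc k + size l) = word r' (Suc k + size l')"
    using Node.prems unfolding t' by (auto simp: append_Cons_eq_iff set_word)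
  moreover from this have "size l = size l'"
    by (metis length_word)
  ultimately show ?case
    using Node.IH t' by auto
qed

text \<open>
  An occurrence of 312 through the first letter has it as its largest letter, so only pairs of
  later letters matter; with \<^const>\<open>sorted_wrt\<close>, appending words needs no index arithmetic.
\<close>

lemma avoids_312_Cons:
  "avoids_312 (x # w) \<longleftrightarrow> avoids_312 w \<and> sorted_wrt (\<lambda>b c. \<not> (b < c \<and> c < x)) w"
proof
  assume *: "avoids_312 (x # w)"
  show "avoids_312 w \<and> sorted_wrt (\<lambda>b c. \<not> (b < c \<and> c < x)) w"
  proof
    show "avoids_312 w"
      unfolding avoids_312_def
    proof
      assume "\<exists>i j k. i < j \<and> j < k \<and> k < length w \<and> w ! i > w ! k \<and> w ! k > w ! j"
      then obtain i j k where "i < j" "j < k" "k < length w" "w ! i > w ! k" "w ! k > w ! j"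
        by blast
      then show False
        using *[unfolded avoids_312_def, simplified, rule_format, of "Suc i" "Suc j" "Suc k"]
        by auto
    qed
    show "sorted_wrt (\<lambda>b c. \<not> (b < c \<and> c < x)) w"
      unfolding sorted_wrt_iff_nth_less
    proof (intro allI impI)
      fix j k assume "j < k" "k < length w"
      then show "\<not> (w ! j < w ! k \<and> w ! k < x)"
        using *[unfolded avoids_312_def, simplified, rule_format, of 0 "Suc j" "Suc k"]
        by auto
    qed
  qed
next
  assume *: "avoids_312 w \<and> sorted_wrt (\<lambda>b c. \<not> (b < c \<and> c < x)) w"
  show "avoids_312 (x # w)"
    unfolding avoids_312_def
  proof
    assume "\<exists>i j k. i < j \<and> j < k \<and> k < length (x # w) \<and>
      (x # w) ! i > (x # w) ! k \<and> (x # w) ! k > (x # w) ! j"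
    then obtain i j k where ijk: "i < j" "j < k" "k < length (x # w)"
      "(x # w) ! i > (x # w) ! k" "(x # w) ! k > (x # w) ! j" by blast
    obtain j' where j: "j = Suc j'"
      using ijk(1) by (cases j) auto
    obtain k' where k: "k = Suc k'"
      using ijk(2) by (cases k) auto
    show False
    proof (cases i)
      case 0
      then have "j' < k'" "k' < length w" "w ! j' < w ! k'" "w ! k' < x"
        using ijk j k by auto
      then show False
        using * unfolding sorted_wrt_iff_nth_less by blast
    next
      case (Suc i')
      then have "i' < j'" "j' < k'" "k' < length w" "w ! i' > w ! k'" "w ! k' > w ! j'"
        using ijk j k by auto
      then show False
        using * unfolding avoids_312_def by blast
    qed
  qed
qed

lemma avoids_312_Nil [simp]: "avoids_312 []"
  by (simp add: avoids_312_def)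

text \<open>
  An occurrence of 312 not inside \<open>A\<close> or \<open>B\<close> has its largest letter in \<open>A\<close> and its last
  letter in \<open>B\<close>, so it is excluded by \<open>A \<le> B\<close>; conversely a letter of \<open>A\<close> above a letter of
  \<open>B\<close> completes \<open>c\<close> to an occurrence.
\<close>

lemma avoids_312_split_at_min:
  assumes "\<forall>a\<in>set A. c < a" and "\<forall>b\<in>set B. c < b"
  shows "avoids_312 (A @ c # B) \<longleftrightarrow>
    avoids_312 A \<and> avoids_312 B \<and> (\<forall>a\<in>set A. \<forall>b\<in>set B. a \<le> b)"
  using assms
proof (induction A)
  case Nil
  then have "sorted_wrt (\<lambda>b d. \<not> (b < d \<and> d < c)) B"
    by (auto simp: sorted_wrt_iff_nth_less dest: order.asym)
  then show ?case
    by (simp add: avoids_312_Cons)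
next
  case (Cons a A)
  have "sorted_wrt (\<lambda>b d. \<not> (b < d \<and> d < a)) B" if "\<forall>b\<in>set B. a \<le> b"
    using that by (auto simp: sorted_wrt_iff_nth_less not_less)
  moreover have "(\<forall>b\<in>set B. \<not> (c < b \<and> b < a)) \<longleftrightarrow> (\<forall>b\<in>set B. a \<le> b)"
    using Cons.prems by (meson not_less)
  moreover have "\<forall>b\<in>set A. \<not> (b < c \<and> c < a)"
    using Cons.prems by (auto dest: order.asym)
  ultimately have "sorted_wrt (\<lambda>b d. \<not> (b < d \<and> d < a)) (A @ c # B) \<longleftrightarrow>
      sorted_wrt (\<lambda>b d. \<not> (b < d \<and> d < a)) A \<and> (\<forall>b\<in>set B. a \<le> b)"
    by (auto simp: sorted_wrt_append)
  moreover have "avoids_312 (A @ c # B) \<longleftrightarrow>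
      avoids_312 A \<and> avoids_312 B \<and> (\<forall>a\<in>set A. \<forall>b\<in>set B. a \<le> b)"
    using Cons.IH Cons.prems by simp
  ultimately show ?case
    unfolding append_Cons avoids_312_Cons list.set by blast
qed

lemma avoids_312_word: "avoids_312 (word t k)"
proof (induction t arbitrary: k)
  case (Node l r)
  have "\<forall>a\<in>set (word l (Suc k)). Suc k < a" "\<forall>b\<in>set (word r (Suc k + size l)). Suc k < b"
    "\<forall>a\<in>set (word l (Suc k)). \<forall>b\<in>set (word r (Suc k + size l)). a \<le> b"
    by (auto simp: set_word)
  with Node show ?case
    by (simp only: word.simps avoids_312_split_at_min simp_thms)
qed simp

lemma lower_part_of_interval:
  fixes k :: nat
  assumes ST: "S \<union> T = {k<..m}" and less: "\<forall>s\<in>S. \<forall>t\<in>T. s < t"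
  shows "S = {k<..k + card S}" and "T = {k + card S<..m}"
proof -
  have sub: "S \<subseteq> {k<..m}"
    using ST by blast
  have "finite S"
    using sub by (rule finite_subset) simp
  define p where "p = Max (insert k S)"
  have p: "p = k \<or> p \<in> S" "k \<le> p" "\<And>s. s \<in> S \<Longrightarrow> s \<le> p"
    using Max_in[of "insert k S"] \<open>finite S\<close> by (auto simp: p_def)
  have S: "S = {k<..p}"
  proof
    show "S \<subseteq> {k<..p}"
      using sub p(3) by auto
    show "{k<..p} \<subseteq> S"
    proof
      fix x assume x: "x \<in> {k<..p}"
      then have "p \<in> S" using p(1) by auto
      then have "x \<in> {k<..m}" using x sub by auto
      then have "x \<in> S \<or> x \<in> T" using ST by blast
      moreover have "x \<notin> T"
        using less \<open>p \<in> S\<close> x by (meson greaterThanAtMost_iff leD)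
      ultimately show "x \<in> S" by blast
    qed
  qed
  then have card: "k + card S = p"
    using p(2) by simp
  with S show "S = {k<..k + card S}" by simp
  have "T = {k<..m} - S"
    using ST less by blast
  moreover have "p = k \<or> p \<le> m"
    using p(1) sub by auto
  ultimately have "T = {p<..m}"
    unfolding S using p(2) by auto
  then show "T = {k + card S<..m}"
    using card by simp
qed

text \<open>
  The two sides of the least letter consist of consecutive values, so they are again words of
  the same kind, with shifted \<open>k\<close>.
\<close>

lemma avoids_312_imp_word:
  assumes "distinct \<pi>" "set \<pi> = {k<..k + length \<pi>}" "avoids_312 \<pi>"
  shows "\<exists>t. word t k = \<pi>"
  using assms
proof (induction "length \<pi>" arbitrary: \<pi> k rule: less_induct)
  case less
  show ?case
  proof (cases "\<pi> = []")
    case True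
    then show ?thesis by (intro exI[of _ Empty]) simp
  next
    case False
    then have "Suc k \<in> set \<pi>"
      using less.prems(2) by (auto simp: Suc_le_eq)
    then obtain A B where \<pi>: "\<pi> = A @ Suc k # B"
      by (meson split_list)
    have "Suc k \<notin> set A \<union> set B"
      using less.prems(1) unfolding \<pi> by auto
    moreover have "insert (Suc k) (set A \<union> set B) = {k<..k + length \<pi>}"
      using less.prems(2) unfolding \<pi> by simp
    ultimately have "set A \<union> set B = {k<..k + length \<pi>} - {Suc k}"
      by blast
    also have "\<dots> = {Suc k<..k + length \<pi>}"
      by auto
    finally have AB: "set A \<union> set B = {Suc k<..k + length \<pi>}" .
    then have "\<forall>x\<in>set A \<union> set B. Suc k < x"
      by simp
    then have avoids: "avoids_312 A" "avoids_312 B" and le: "\<forall>a\<in>set A. \<forall>b\<in>set B. a \<le> b"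
      using less.prems(3) avoids_312_split_at_min[of A "Suc k" B] unfolding \<pi> by blast+
    have dist: "distinct A" "distinct B" "set A \<inter> set B = {}"
      using less.prems(1) unfolding \<pi> by auto
    have "\<forall>a\<in>set A. \<forall>b\<in>set B. a < b"
      using le dist(3) by (metis disjoint_iff le_neq_implies_less)
    note lower_part_of_interval[OF AB this]
    then have "set A = {Suc k<..Suc k + length A}"
      "set B = {Suc k + length A<..Suc k + length A + length B}"
      using \<pi> dist by (simp_all add: distinct_card add.assoc)
    then obtain l r where "word l (Suc k) = A" "word r (Suc k + length A) = B"
      using less.hyps[OF _ dist(1) _ avoids(1)] less.hyps[OF _ dist(2) _ avoids(2)] \<pi> by force
    then have "word (Node l r) k = \<pi>"
      using \<pi> by (auto simp flip: length_word[of l "Suc k"])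
    then show ?thesis ..
  qed
qed

lemma bij_betw_word: "bij_betw (\<lambda>t. word t 0) {t. size t = n} (perms_312 n)"
proof (rule bij_betw_imageI)
  show "inj_on (\<lambda>t. word t 0) {t. size t = n}"
    by (auto intro: inj_onI word_inject)
  have "\<pi> \<in> (\<lambda>t. word t 0) ` {t. size t = n}" if "\<pi> \<in> perms_312 n" for \<pi>
  proof -
    have \<pi>: "set \<pi> = {1..n}" "distinct \<pi>" "avoids_312 \<pi>"
      using that by (auto simp: perms_312_def permutations_of_set_def)
    then have "length \<pi> = n"
      by (metis card_atLeastAtMost diff_Suc_1 distinct_card)
    moreover obtain t where "word t 0 = \<pi>"
      using avoids_312_imp_word[of \<pi> 0] \<pi> calculation by (auto simp: greaterThanAtMost_def
        atLeastAtMost_def greaterThan_def atLeast_def Suc_le_eq)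
    ultimately show ?thesis
      using length_word[of t 0] by auto
  qed
  then show "(\<lambda>t. word t 0) ` {t. size t = n} = perms_312 n"
    by (auto simp: perms_312_def permutations_of_set_def set_word distinct_word avoids_312_word)
qed

section \<open>The statistics on trees\<close>

fun nodes :: "(bool \<Rightarrow> bool \<Rightarrow> bool) \<Rightarrow> tree \<Rightarrow> nat" where
  "nodes Q Empty = 0"
| "nodes Q (Node l r) = of_bool (Q (l \<noteq> Empty) (r \<noteq> Empty)) + nodes Q l + nodes Q r"

fun single_left :: "tree \<Rightarrow> nat" where
  "single_left Empty = 0"
| "single_left (Node l r) = of_bool (size l = 1 \<and> r \<noteq> Empty) + single_left l + single_left r"

fun single_right :: "tree \<Rightarrow> nat" where
  "single_right Empty = 0"
| "single_right (Node l r) = of_bool (size r = 1 \<and> l \<noteq> Empty) + single_right l + single_right r"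

text \<open>
  The bounding letters \<open>x\<close> and \<open>y\<close> stand for the letters surrounding a subtree inside the padded
  word: these are ancestors or the padding, hence smaller than all letters of the subtree. They
  vary in the induction, because the root becomes a bounding letter of its two subtrees.
\<close>

lemma windows_3_word:
  assumes P: "\<And>a b c. a \<noteq> b \<Longrightarrow> c \<noteq> b \<Longrightarrow> P [a, b, c] \<longleftrightarrow> Q (b < a) (b < c)"
    and "x \<le> k" "y \<le> k"
  shows "windows 3 P (x # word t k @ [y]) = nodes Q t"
  using assms(2,3)
proof (induction t arbitrary: k x y)
  case Empty
  then show ?case by (simp add: windows_short)
next
  case (Node l r)
  let ?A = "word l (Suc k)" and ?B = "word r (Suc k + size l)"
  obtain u a where u: "x # ?A = u @ [a]"
    by (metis append_butlast_last_id list.distinct(1))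
  obtain b v where v: "?B @ [y] = b # v"
    by (cases "?B @ [y]") auto
  have a: "a = (if l = Empty then x else last ?A)"
    using u by (metis last.simps last_snoc word_eq_Nil_iff)
  have b: "b = (if r = Empty then y else hd ?B)"
    using v by (metis hd_append2 list.sel(1) append_Nil word_eq_Nil_iff)
  have "a \<noteq> Suc k \<and> (Suc k < a \<longleftrightarrow> l \<noteq> Empty)"
  proof (cases "l = Empty")
    case False
    then have "last ?A \<in> set ?A" by simp
    then show ?thesis using a False by (auto simp: set_word)
  qed (use a Node.prems in auto)
  moreover have "b \<noteq> Suc k \<and> (Suc k < b \<longleftrightarrow> r \<noteq> Empty)"
  proof (cases "r = Empty")
    case False
    then have "hd ?B \<in> set ?B" by simp
    then show ?thesis using b False by (auto simp: set_word)
  qed (use b Node.prems in auto)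
  ultimately have mid: "P [a, Suc k, b] \<longleftrightarrow> Q (l \<noteq> Empty) (r \<noteq> Empty)"
    using P[of a "Suc k" b] by simp
  have "x # word (Node l r) k @ [y] = u @ [a, Suc k] @ b # v"
    using u v by simp
  then have "windows 3 P (x # word (Node l r) k @ [y]) =
      windows 3 P (u @ [a, Suc k]) + windows 3 P ([a, Suc k] @ b # v)"
    using windows_overlap[of "[a, Suc k]" 3 P u "b # v"] by simp
  also have "u @ [a, Suc k] = x # ?A @ [Suc k]"
    using u by simp
  also have "windows 3 P (x # ?A @ [Suc k]) = nodes Q l"
    using Node by auto
  also have "windows 3 P ([a, Suc k] @ b # v) =
      of_bool (P [a, Suc k, b]) + windows 3 P (Suc k # ?B @ [y])"
    using v by (simp add: windows_Cons[of 3 P a])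
  also have "windows 3 P (Suc k # ?B @ [y]) = nodes Q r"
    using Node by auto
  finally show ?case using mid by simp
qed

text \<open>
  An occurrence whose third letter is the root needs a letter below the root two places before
  it, which forces the left subtree to be a single node; the bounding letter \<open>x\<close> serves as that
  smaller letter. All other occurrences lie within one subtree and the letter in front of it.
\<close>

lemma windows_1324_word:
  assumes P: "\<And>a b c d. P [a, b, c, d] \<longleftrightarrow> a < c \<and> c < b \<and> b < d"
    and "x \<le> k"
  shows "windows 4 P (x # word t k) = single_left t"
  using assms(2)
proof (induction t arbitrary: k x)
  case Empty
  then show ?case by (simp add: windows_short)
next
  case (Node l r)
  let ?A = "word l (Suc k)" and ?B = "word r (Suc k + size l)"
  have A: "windows 4 P (x # ?A) = single_left l" and B: "windows 4 P (Suc k # ?B) = single_left r"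
    using Node by auto
  \<comment> \<open>The root is smaller than its successor, so it cannot be the second letter of a 1324.\<close>
  have second: "windows 4 P (q # Suc k # ?B) = windows 4 P (Suc k # ?B)" for q
  proof (cases "\<exists>b b' v. ?B = b # b' # v")
    case True
    then obtain b b' v where bv: "?B = b # b' # v" by blast
    then have "b \<in> set ?B" by simp
    then show ?thesis using bv by (auto simp: windows_Cons[of 4 P q] P set_word)
  next
    case False
    then have "length ?B < 2"
      by (cases ?B; cases "tl ?B") auto
    then show ?thesis by (simp add: windows_short)
  qed
  show ?case
  proof (cases "l = Empty")
    case True
    then show ?thesis using B second[of x] by simp
  next
    case False
    obtain A' d where A': "?A = A' @ [d]"
      using False by (metis rev_exhaust word_eq_Nil_iff)
    obtain v e where "x # A' = v @ [e]"
      by (metis rev_exhaust list.distinct(1))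
    then have ved: "x # ?A = v @ [e, d]"
      using A' by simp
    have "d \<in> set ?A"
      using A' by simp
    then have d: "Suc k < d" "\<forall>b\<in>set ?B. d < b"
      by (auto simp: set_word)
    have e: "e < Suc k \<longleftrightarrow> size l = 1"
    proof (cases v)
      case Nil
      then show ?thesis
        using ved Node.prems length_word[of l "Suc k"] by auto
    next
      case (Cons z v')
      then have "?A = v' @ [e, d]" using ved by simp
      then have "e \<in> set ?A" "size l \<noteq> 1"
        using length_word[of l "Suc k"] by auto
      then show ?thesis by (auto simp: set_word)
    qed
    \<comment> \<open>Nor is it the last letter of a 1324, being smaller than its predecessor.\<close>
    have last: "windows 4 P (v @ [e, d, Suc k]) = windows 4 P (v @ [e, d])"
    proof (cases v rule: rev_cases)
      case (snoc u s)
      have "windows 4 P (u @ [s, e, d] @ [Suc k]) =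
          windows 4 P (u @ [s, e, d]) + windows 4 P ([s, e, d] @ [Suc k])"
        by (rule windows_overlap) simp
      then show ?thesis
        using snoc d by (simp add: windows_Cons windows_short P)
    qed (simp add: windows_short)
    have "windows 4 P (v @ [e, d, Suc k] @ ?B) =
        windows 4 P (v @ [e, d, Suc k]) + windows 4 P ([e, d, Suc k] @ ?B)"
      by (rule windows_overlap) simp
    moreover have "windows 4 P ([e, d, Suc k] @ ?B) =
        of_bool (size l = 1 \<and> r \<noteq> Empty) + windows 4 P (d # Suc k # ?B)"
    proof (cases ?B)
      case Nil
      then show ?thesis by (simp add: windows_Cons[of 4 P e])
    next
      case (Cons b B')
      then have "d < b" "r \<noteq> Empty" using d by auto
      then show ?thesis using Cons d e by (simp add: windows_Cons[of 4 P e] P)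
    qed
    moreover have W: "x # word (Node l r) k = v @ [e, d, Suc k] @ ?B"
      using ved by simp
    ultimately show ?thesis
      unfolding W using A[unfolded ved] B second[of d] last by simp
  qed
qed

text \<open>
  The mirror image of the previous argument: now the letter below the root stands two places
  after it, and the bounding letter is the one behind the subtree. The inequality between the
  letters on the two sides of the root still comes from left letters being smaller.
\<close>

lemma windows_3241_word:
  assumes P: "\<And>a b c d. P [a, b, c, d] \<longleftrightarrow> d < b \<and> b < a \<and> a < c"
    and "y \<le> k"
  shows "windows 4 P (word t k @ [y]) = single_right t"
  using assms(2)
proof (induction t arbitrary: k y)
  case Empty
  then show ?case by (simp add: windows_short)
next
  case (Node l r)
  let ?A = "word l (Suc k)" and ?B = "word r (Suc k + size l)"
  have A: "windows 4 P (?A @ [Suc k]) = single_right l" and B: "windows 4 P (?B @ [y]) = single_right r"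
    using Node by auto
  have gtA: "\<forall>a\<in>set ?A. Suc k < a"
    by (auto simp: set_word)
  \<comment> \<open>The root is smaller than all letters of the left subtree, so it cannot be the third letter
    of a 3241.\<close>
  have third: "windows 4 P (?A @ [Suc k, q]) = windows 4 P (?A @ [Suc k])" for q
  proof (cases "\<exists>u a b. ?A = u @ [a, b]")
    case True
    then obtain u a b where u: "?A = u @ [a, b]" by blast
    have "windows 4 P (u @ [a, b, Suc k] @ [q]) =
        windows 4 P (u @ [a, b, Suc k]) + windows 4 P ([a, b, Suc k] @ [q])"
      by (rule windows_overlap) simp
    then show ?thesis
      using u gtA by (simp add: windows_Cons windows_short P)
  next
    case False
    then have "length ?A < 2"
      by (cases ?A rule: rev_cases; cases "butlast ?A" rule: rev_cases) auto
    then show ?thesis by (simp add: windows_short)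
  qed
  show ?case
  proof (cases "r = Empty")
    case True
    then show ?thesis using A third[of y] by simp
  next
    case False
    then obtain d B' where dB': "?B = d # B'"
      by (meson list.exhaust word_eq_Nil_iff)
    obtain e v where ev: "B' @ [y] = e # v"
      by (cases "B' @ [y]") auto
    have "d \<in> set ?B" using dB' by simp
    then have d: "Suc k < d" "\<forall>a\<in>set ?A. a < d"
      by (auto simp: set_word)
    have e: "e < Suc k \<longleftrightarrow> size r = 1"
    proof (cases B')
      case Nil
      then show ?thesis
        using dB' ev Node.prems length_word[of r "Suc k + size l"] by auto
    next
      case (Cons z B'')
      then have "e \<in> set ?B" "size r \<noteq> 1"
        using dB' ev length_word[of r "Suc k + size l"] by auto
      then show ?thesis by (auto simp: set_word)
    qed
    \<comment> \<open>Nor is it the first letter of a 3241, being smaller than its successor.\<close>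
    have first: "windows 4 P (Suc k # d # e # v) = windows 4 P (d # e # v)"
      using d by (cases v) (auto simp: windows_Cons[of 4 P "Suc k"] P)
    have W: "word (Node l r) k @ [y] = ?A @ Suc k # d # e # v"
      using dB' ev by simp
    have "windows 4 P (?A @ Suc k # d # e # v) =
        windows 4 P (?A @ [Suc k, d]) + of_bool (size r = 1 \<and> l \<noteq> Empty)
        + windows 4 P (Suc k # d # e # v)"
    proof (cases ?A rule: rev_cases)
      case Nil
      then show ?thesis by (simp add: windows_short)
    next
      case (snoc u a)
      then have "a < d" "Suc k < a" "l \<noteq> Empty" using d gtA by auto
      moreover have "windows 4 P (u @ [a, Suc k, d] @ e # v) =
          windows 4 P (u @ [a, Suc k, d]) + windows 4 P ([a, Suc k, d] @ e # v)"
        by (rule windows_overlap) simp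
      ultimately show ?thesis
        using snoc e by (simp add: windows_Cons[of 4 P a] P)
    qed
    then show ?thesis
      using A B W third[of d] first dB' ev by simp
  qed
qed

lemma order_isomorphic_1324:
  "order_isomorphic [a, b, c, d] [1, 3, 2, 4] \<longleftrightarrow> a < c \<and> c < b \<and> b < d"
  by (auto simp: order_isomorphic_def All_less_Suc numeral_eq_Suc)

lemma order_isomorphic_3241:
  "order_isomorphic [a, b, c, d] [3, 2, 4, 1] \<longleftrightarrow> d < b \<and> b < a \<and> a < c"
  by (auto simp: order_isomorphic_def All_less_Suc numeral_eq_Suc)

lemma consecutive_occurrences_eq_windows:
  "length \<sigma> = k \<Longrightarrow> consecutive_occurrences \<sigma> w = windows k (\<lambda>v. order_isomorphic v \<sigma>) w"
  by (simp add: consecutive_occurrences_def windows_def)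

lemma st1_word: "st\<^sub>1 (word t 0) = single_left t"
  unfolding st\<^sub>1_def
  by (subst consecutive_occurrences_eq_windows[where k = 4])
    (simp, intro windows_1324_word order_isomorphic_1324 order_refl)

lemma st2_word: "st\<^sub>2 (word t 0) = single_right t"
  unfolding st\<^sub>2_def
  by (subst consecutive_occurrences_eq_windows[where k = 4])
    (simp, intro windows_3241_word order_isomorphic_3241 order_refl)

lemma pk_word: "pk (word t 0) = nodes (\<lambda>l r. \<not> l \<and> \<not> r) t"
  unfolding pk_def card_padded_triples[of _ "\<lambda>a b c. a < b \<and> b > c"]
  by (rule windows_3_word) auto

lemma dd_word: "dd (word t 0) = nodes (\<lambda>l r. l \<and> \<not> r) t"
  unfolding dd_def card_padded_triples[of _ "\<lambda>a b c. a > b \<and> b > c"]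
  by (rule windows_3_word) auto

lemma da_word: "da (word t 0) = nodes (\<lambda>l r. \<not> l \<and> r) t"
  unfolding da_def card_padded_triples[of _ "\<lambda>a b c. a < b \<and> b < c"]
  by (rule windows_3_word) auto

section \<open>Exchanging the subtrees at nodes with two children\<close>

fun twist :: "tree \<Rightarrow> tree" where
  "twist Empty = Empty"
| "twist (Node l r) =
     (if l = Empty \<or> r = Empty then Node (twist l) (twist r) else Node (twist r) (twist l))"

lemma size_twist [simp]: "size (twist t) = size t"
  by (induction t) auto

lemma twist_eq_Empty_iff [simp]: "twist t = Empty \<longleftrightarrow> t = Empty"
  by (cases t) auto

lemma twist_twist [simp]: "twist (twist t) = t"
  by (induction t) auto

lemma nodes_twist: "nodes Q (twist t) = nodes Q t"
  by (induction t) auto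

lemma single_left_twist: "single_left (twist t) = single_right t"
  by (induction t) auto

lemma single_right_twist: "single_right (twist t) = single_left t"
  by (induction t) auto

theorem theorem3p7:
  fixes n :: nat
  assumes "n \<ge> 1"
  shows "\<exists>\<Upsilon> :: nat list \<Rightarrow> nat list. involution_on (perms_312 n) \<Upsilon> \<and>
    (\<forall>\<pi> \<in> perms_312 n.
       (pk (\<Upsilon> \<pi>), dd (\<Upsilon> \<pi>), da (\<Upsilon> \<pi>)) = (pk \<pi>, dd \<pi>, da \<pi>) \<and>
       (st\<^sub>1 (\<Upsilon> \<pi>), st\<^sub>2 (\<Upsilon> \<pi>)) = (st\<^sub>2 \<pi>, st\<^sub>1 \<pi>))"
proof -
  let ?T = "{t. size t = n}" and ?w = "\<lambda>t. word t 0"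
  define \<Upsilon> where "\<Upsilon> \<pi> = ?w (twist (the_inv_into ?T ?w \<pi>))" for \<pi>
  have \<Upsilon>: "\<Upsilon> (?w t) = ?w (twist t)" if "t \<in> ?T" for t
    using the_inv_into_f_f[of ?w ?T t] bij_betw_word[of n] that
    unfolding \<Upsilon>_def bij_betw_def by simp
  have perms: "perms_312 n = ?w ` ?T"
    using bij_betw_word[of n] by (simp add: bij_betw_def)
  have "involution_on (perms_312 n) \<Upsilon>"
    unfolding involution_on_def perms by (auto simp: \<Upsilon>)
  then show ?thesis
    unfolding perms
    by (intro exI[of _ \<Upsilon>])
      (auto simp: \<Upsilon> pk_word dd_word da_word st1_word st2_word nodes_twist
        single_left_twist single_right_twist)
qed

end
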